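(* Suppose the EM sequence $\{\theta^{(t)}\}_{t\ge0}$ converges to a point $\theta^*\in\Theta$, a stationary point of the log-likelihood $l(\cdot;y)$. Further suppose that $l(\theta;y)$, $Q(\theta\mid\tilde\theta;y)$, and $R(\theta\mid\tilde\theta;y)$ are twice continuously differentiable in $\theta$ and that the matrices $\nabla^2 l(\theta^*;y)$, $\nabla^2 Q(\theta^*\mid\theta^*;y)$, and $\nabla^2 R(\theta^*\mid\theta^*;y)$ have full rank. Then the convergence of $\{\theta^{(t)}\}$ to $\theta^*$ is not superlinear.
   Context: Setting: $(Y,U)$ is a random vector with $Y\in\mathbb{R}^N$ and $U\in\mathbb{R}^q$, having density $f(y,u;\theta)$ with respect to a product measure $\lambda\times\mu$ ($\lambda$ a measure on $\mathbb{R}^N$, $\mu$ a measure on $\mathbb{R}^q$), indexed by $\theta\in\Theta$, where $\Theta$ is an open subset of $\mathbb{R}^d$. Only $Y=y$ is observed, and $y$ is fixed. The likelihood is $L(\theta;y)=\int f(y,u;\theta)\,\mu(du)$ and the log-likelihood is $l(\theta;y)=\log L(\theta;y)$. The conditional density of $U$ given $Y=y$ is $h(u\mid y;\theta)=f(y,u;\theta)/L(\theta;y)$. The functions $Q$ and $R$ are the (real-valued) mappings on $\Theta\times\Theta$ $$Q(\theta\mid\tilde\theta;y)=\mathrm{E}\{\log f(y,U;\theta)\mid y;\tilde\theta\}=\int \log f(y,u;\theta)\,h(u\mid y;\tilde\theta)\,\mu(du),$$ $$R(\theta\mid\tilde\theta;y)=\mathrm{E}\{\log h(U\mid y;\theta)\mid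 y;\tilde\theta\}=Q(\theta\mid\tilde\theta;y)-l(\theta;y).$$ An EM sequence is a sequence $\{\theta^{(t)}:t=0,1,2,\dots\}$ in $\Theta$ such that, for every $t$, $Q(\theta^{(t+1)}\mid\theta^{(t)};y)\ge Q(\theta\mid\theta^{(t)};y)$ for all $\theta\in\Theta$. The symbols $\nabla,\nabla^2$ denote gradient and Hessian with respect to the first argument $\theta$. A sequence $\{\theta^{(t)}\}$ converging to $\theta^*$ converges superlinearly if $\theta^{(t+1)}-\theta^*=o(\|\theta^{(t)}-\theta^*\|)$ as $t\to\infty$, where $\|\cdot\|$ is the Euclidean norm.
   Formalization: The formal theorem additionally assumes that the EM sequence is not eventually equal to θ* (otherwise 0 = o(0) makes it superlinear) and that the Hessian ∇²R(θ|θ̃;y) is jointly continuous in (θ,θ̃) at (θ*,θ* ), not merely continuous in θ for each fixed θ̃. *)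

theory Defs
  imports "HOL-Probability.Probability" "HOL-Library.Landau_Symbols"
begin

section \<open>Gradient and Hessian\<close>

definition gradient :: "(real^'d \<Rightarrow> real) \<Rightarrow> real^'d \<Rightarrow> real^'d" where
  "gradient F x = (\<chi> i. frechet_derivative F (at x) (axis i 1))"

definition hessian :: "(real^'d \<Rightarrow> real) \<Rightarrow> real^'d \<Rightarrow> real^'d^'d" where
  "hessian F x = matrix (frechet_derivative (gradient F) (at x))"

text \<open>Meant for open \<open>S\<close>: the derivatives are two-sided, so \<open>F\<close> must be
  differentiable on a neighbourhood of each point of \<open>S\<close>.\<close>

definition C2_on :: "(real^'d) set \<Rightarrow> (real^'d \<Rightarrow> real) \<Rightarrow> bool" where
  "C2_on S F \<longleftrightarrow>
     (\<forall>x\<in>S. F differentiable (at x)) \<and>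
     (\<forall>x\<in>S. gradient F differentiable (at x)) \<and>
     continuous_on S (hessian F)"

section \<open>Likelihood, conditional density, and the functions Q and R\<close>

text \<open>In all of the following, \<open>f y u \<theta>\<close> is the joint density of \<open>(Y, U)\<close> at \<open>(y, u)\<close> under the
  parameter \<open>\<theta>\<close>, and \<open>mu\<close> is the dominating measure of the unobserved component.\<close>

definition likelihood ::
  "(real^'q) measure \<Rightarrow> (real^'n \<Rightarrow> real^'q \<Rightarrow> real^'d \<Rightarrow> real) \<Rightarrow> real^'n \<Rightarrow> real^'d \<Rightarrow> real" where
  "likelihood mu f y \<theta> = (\<integral>u. f y u \<theta> \<partial>mu)"

definition loglik ::
  "(real^'q) measure \<Rightarrow> (real^'n \<Rightarrow> real^'q \<Rightarrow> real^'d \<Rightarrow> real) \<Rightarrow> real^'n \<Rightarrow> real^'d \<Rightarrow> real" where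
  "loglik mu f y \<theta> = ln (likelihood mu f y \<theta>)"

definition cond_density ::
  "(real^'q) measure \<Rightarrow> (real^'n \<Rightarrow> real^'q \<Rightarrow> real^'d \<Rightarrow> real) \<Rightarrow> real^'n \<Rightarrow> real^'d \<Rightarrow> real^'q \<Rightarrow> real"
  where "cond_density mu f y \<theta> u = f y u \<theta> / likelihood mu f y \<theta>"

definition Qfun ::
  "(real^'q) measure \<Rightarrow> (real^'n \<Rightarrow> real^'q \<Rightarrow> real^'d \<Rightarrow> real) \<Rightarrow> real^'n
     \<Rightarrow> real^'d \<Rightarrow> real^'d \<Rightarrow> real" where
  "Qfun mu f y \<theta> \<theta>' = (\<integral>u. ln (f y u \<theta>) * cond_density mu f y \<theta>' u \<partial>mu)"

definition Rfun ::
  "(real^'q) measure \<Rightarrow> (real^'n \<Rightarrow> real^'q \<Rightarrow> real^'d \<Rightarrow> real) \<Rightarrow> real^'n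
     \<Rightarrow> real^'d \<Rightarrow> real^'d \<Rightarrow> real" where
  "Rfun mu f y \<theta> \<theta>' = (\<integral>u. ln (cond_density mu f y \<theta> u) * cond_density mu f y \<theta>' u \<partial>mu)"

text \<open>The expectation of \<open>log g\<close> under the density \<open>h\<close> is a well-defined real number. Since
  \<open>ln 0 = 0\<close> and non-integrable functions have integral \<open>0\<close> in HOL, the integrals in
  \<open>Qfun\<close> and \<open>Rfun\<close> have their intended meaning only under this condition; its first
  conjunct says that \<open>log g = -\<infinity>\<close> occurs with \<open>h\<close>-probability zero.\<close>

definition real_log_expectation ::
  "'u measure \<Rightarrow> ('u \<Rightarrow> real) \<Rightarrow> ('u \<Rightarrow> real) \<Rightarrow> bool" where
  "real_log_expectation mu g h \<longleftrightarrow>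
     (AE u in mu. h u > 0 \<longrightarrow> g u > 0) \<and> integrable mu (\<lambda>u. ln (g u) * h u)"

section \<open>EM sequences and superlinear convergence\<close>

definition em_sequence ::
  "'p set \<Rightarrow> ('p \<Rightarrow> 'p \<Rightarrow> real) \<Rightarrow> (nat \<Rightarrow> 'p) \<Rightarrow> bool" where
  "em_sequence \<Theta> Q \<theta> \<longleftrightarrow>
     (\<forall>t. \<theta> t \<in> \<Theta>) \<and> (\<forall>t. \<forall>\<theta>'\<in>\<Theta>. Q (\<theta> (Suc t)) (\<theta> t) \<ge> Q \<theta>' (\<theta> t))"

text \<open>A sequence that is eventually equal to its limit satisfies this trivially, as \<open>0 = o(0)\<close>;
  negative results about superlinear convergence have to exclude that case separately.\<close>

definition converges_superlinearly ::
  "(nat \<Rightarrow> 'a::real_normed_vector) \<Rightarrow> 'a \<Rightarrow> bool" where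
  "converges_superlinearly x l \<longleftrightarrow>
     x \<longlonglongrightarrow> l \<and> (\<lambda>t. norm (x (Suc t) - l)) \<in> o(\<lambda>t. norm (x t - l))"

end

theory Submission
  imports Defs
begin

text \<open>
  By Gibbs' inequality \<open>R(\<cdot>|\<theta>')\<close> is maximal at \<open>\<theta>'\<close>, so \<open>\<nabla>R(\<theta>'|\<theta>') = 0\<close>, and
  \<open>\<nabla>Q(\<theta>\<^sub>t\<^sub>+\<^sub>1|\<theta>\<^sub>t) = 0\<close> by the M-step. Since \<open>l = Q - R\<close>, this gives
  \<open>\<nabla>l(\<theta>\<^sub>t\<^sub>+\<^sub>1) = \<nabla>R(\<theta>\<^sub>t|\<theta>\<^sub>t) - \<nabla>R(\<theta>\<^sub>t\<^sub>+\<^sub>1|\<theta>\<^sub>t)\<close>. The left side is \<open>O(\<theta>\<^sub>t\<^sub>+\<^sub>1 - \<theta>*)\<close>, while the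
  right side is at least \<open>c \<parallel>\<theta>\<^sub>t\<^sub>+\<^sub>1 - \<theta>\<^sub>t\<parallel>\<close> for some \<open>c > 0\<close> because the Hessian of \<open>R\<close> is
  invertible at \<open>\<theta>*\<close>. Hence \<open>\<parallel>\<theta>\<^sub>t - \<theta>*\<parallel> = O(\<parallel>\<theta>\<^sub>t\<^sub>+\<^sub>1 - \<theta>*\<parallel>)\<close>.
\<close>

section \<open>Calculus of gradients and Hessians\<close>

lemma gradient_eqI:
  assumes "(F has_derivative F') (at x)"
  shows "gradient F x = (\<chi> i. F' (axis i 1))"
  unfolding gradient_def using frechet_derivative_at[OF assms] by simp

lemma gradient_zero_at_max:
  assumes "open S" "x \<in> S" "F differentiable (at x)" "\<And>z. z \<in> S \<Longrightarrow> F z \<le> F x"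
  shows "gradient F x = 0"
proof -
  have D: "(F has_derivative frechet_derivative F (at x)) (at x)"
    using assms(3) frechet_derivative_works by blast
  have "frechet_derivative F (at x) = (\<lambda>v. 0)"
    using differential_zero_maxmin[OF assms(2,1) D] assms(4) by blast
  then show ?thesis
    by (simp add: gradient_def vec_eq_iff)
qed

text \<open>Differentiability at \<open>x\<close> only sees a neighbourhood, so the identity is
  required on the open set \<open>S\<close> alone; \<open>R = Q - l\<close> is likewise available
  only on the parameter set.\<close>

lemma gradient_diff:
  assumes "open S" "x \<in> S" "\<And>z. z \<in> S \<Longrightarrow> K z = F z - G z"
    and "F differentiable (at x)" "G differentiable (at x)"
  shows "gradient K x = gradient F x - gradient G x"
proof -
  have "((\<lambda>z. F z - G z) has_derivative
      (\<lambda>v. frechet_derivative F (at x) v - frechet_derivative G (at x) v)) (at x)"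
    using assms(4,5) frechet_derivative_works by (blast intro: has_derivative_diff)
  then have "(K has_derivative
      (\<lambda>v. frechet_derivative F (at x) v - frechet_derivative G (at x) v)) (at x)"
    by (rule has_derivative_transform_within_open[OF _ assms(1,2)]) (simp add: assms(3))
  from gradient_eqI[OF this] show ?thesis
    by (simp add: gradient_def vec_eq_iff)
qed

lemma gradient_has_derivative_hessian:
  assumes "gradient F differentiable (at x)"
  shows "(gradient F has_derivative (*v) (hessian F x)) (at x)"
proof -
  have D: "(gradient F has_derivative frechet_derivative (gradient F) (at x)) (at x)"
    using assms frechet_derivative_works by blast
  then have "linear (frechet_derivative (gradient F) (at x))"
    by (rule has_derivative_linear)
  then have "(*v) (hessian F x) = frechet_derivative (gradient F) (at x)"
    unfolding hessian_def by (rule matrix_vector_mul)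
  with D show ?thesis by simp
qed

section \<open>Linear approximation, locally uniform in a parameter\<close>

text \<open>A crude comparison suffices: it turns continuity of a Hessian in the matrix norm into
  the operator norm bound that the mean value inequality demands.\<close>

lemma onorm_matrix_le_norm:
  fixes M :: "real^'m^'n"
  shows "onorm ((*v) M) \<le> real CARD('n) * real CARD('m) * norm M"
proof (rule onorm_le_matrix_component)
  fix i j
  have "\<bar>M $ i $ j\<bar> \<le> norm (M $ i)" by (rule component_le_norm_cart)
  also have "\<dots> \<le> norm M" by (rule Finite_Cartesian_Product.norm_nth_le)
  finally show "\<bar>M $ i $ j\<bar> \<le> norm M" .
qed

text \<open>Subtracting the fixed linear map \<open>H x0 p0\<close> leaves a function of
  \<open>x\<close> with derivative \<open>H x p - H x0 p0\<close>, which joint continuity makes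
  small; the mean value inequality on a ball then applies. One radius serves all \<open>p\<close>,
  as the EM parameter moves with \<open>t\<close>.\<close>

lemma parametric_linear_approximation:
  fixes G :: "real^'d \<Rightarrow> 'p::metric_space \<Rightarrow> real^'n"
  assumes "open S" "x0 \<in> S" "open T" "p0 \<in> T"
    and D: "\<And>x p. x \<in> S \<Longrightarrow> p \<in> T \<Longrightarrow> ((\<lambda>x. G x p) has_derivative (*v) (H x p)) (at x)"
    and cont: "isCont (\<lambda>(x, p). H x p) (x0, p0)"
    and "e > 0"
  obtains d where "d > 0"
    "\<And>x z p. x \<in> ball x0 d \<Longrightarrow> z \<in> ball x0 d \<Longrightarrow> p \<in> ball p0 d \<Longrightarrow>
       norm (G x p - G z p - H x0 p0 *v (x - z)) \<le> e * norm (x - z)"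
proof -
  let ?A = "H x0 p0"
  define k where "k = real CARD('n) * real CARD('d)"
  have k: "k > 0" by (simp add: k_def)
  obtain d0 where d0: "d0 > 0"
    "\<And>w. dist w (x0, p0) < d0 \<Longrightarrow> dist (case w of (x, p) \<Rightarrow> H x p) ?A < e / k"
    using cont k \<open>e > 0\<close> unfolding continuous_at_eps_delta
    by (metis (mono_tags, lifting) case_prod_conv divide_pos_pos)
  obtain d1 where d1: "d1 > 0" "ball x0 d1 \<subseteq> S"
    using assms(1,2) open_contains_ball by blast
  obtain d2 where d2: "d2 > 0" "ball p0 d2 \<subseteq> T"
    using assms(3,4) open_contains_ball by blast
  \<comment> \<open>Half of \<open>d0\<close>, because the distance between pairs is bounded by the
    sum of the two component distances.\<close>
  define d where "d = min (d0 / 2) (min d1 d2)"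
  show thesis
  proof
    show "d > 0" using d0 d1 d2 by (simp add: d_def)
  next
    fix x z p
    assume xz: "x \<in> ball x0 d" "z \<in> ball x0 d" and p: "p \<in> ball p0 d"
    have "norm ((G x p - ?A *v x) - (G z p - ?A *v z)) \<le> e * norm (x - z)"
    proof (rule differentiable_bound[OF convex_ball _ _ xz])
      fix w assume w: "w \<in> ball x0 d"
      have wS: "w \<in> S" and pT: "p \<in> T"
        using w p d1 d2 by (auto simp: d_def)
      have lin: "((*v) ?A has_derivative (*v) ?A) (at w)"
        by (rule bounded_linear_imp_has_derivative) (rule matrix_vector_mul_bounded_linear)
      have "((\<lambda>x. G x p - ?A *v x) has_derivative (\<lambda>v. H w p *v v - ?A *v v)) (at w)"
        by (rule has_derivative_diff[OF D[OF wS pT] lin])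
      also have "(\<lambda>v. H w p *v v - ?A *v v) = (*v) (H w p - ?A)"
        by (simp add: fun_eq_iff matrix_vector_mult_diff_rdistrib)
      finally show "((\<lambda>x. G x p - ?A *v x) has_derivative (*v) (H w p - ?A)) (at w within ball x0 d)"
        by (rule has_derivative_at_withinI)
      have "dist (w, p) (x0, p0) \<le> dist w x0 + dist p p0"
        unfolding dist_Pair_Pair by (rule sqrt_sum_squares_le_sum) auto
      also have "\<dots> < d0"
        using w p by (auto simp: d_def dist_commute)
      finally have "norm (H w p - ?A) < e / k"
        using d0(2)[of "(w, p)"] by (simp add: dist_norm)
      then have "k * norm (H w p - ?A) \<le> e"
        using k by (simp add: field_simps)
      then show "onorm ((*v) (H w p - ?A)) \<le> e"
        using onorm_matrix_le_norm[of "H w p - ?A"] by (simp add: k_def)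
    qed
    then show "norm (G x p - G z p - ?A *v (x - z)) \<le> e * norm (x - z)"
      by (simp add: matrix_vector_mult_diff_distrib algebra_simps)
  qed
qed

text \<open>The derivative contributes its operator bound \<open>B\<close>, and the remainder, taken
  with tolerance 1, contributes 1.\<close>

lemma has_derivative_local_linear_bound:
  assumes "(g has_derivative g') (at x0)" "g x0 = 0"
  obtains K where "K > 0" "\<forall>\<^sub>F x in nhds x0. norm (g x) \<le> K * norm (x - x0)"
proof -
  obtain B where B: "B > 0" "\<And>v. norm (g' v) \<le> norm v * B"
    using has_derivative_bounded_linear[OF assms(1)] bounded_linear.pos_bounded by blast
  obtain d where d: "d > 0"
    "\<And>x. norm (x - x0) < d \<Longrightarrow> norm (g x - g x0 - g' (x - x0)) \<le> 1 * norm (x - x0)"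
    using assms(1) unfolding has_derivative_at_alt by (metis zero_less_one)
  have "norm (g x) \<le> (B + 1) * norm (x - x0)" if "dist x x0 < d" for x
  proof -
    have "norm (g x) \<le> norm (g x - g' (x - x0)) + norm (g' (x - x0))"
      by (metis diff_add_cancel norm_triangle_ineq)
    also have "\<dots> \<le> norm (x - x0) + norm (x - x0) * B"
      using d(2)[of x] that B(2)[of "x - x0"] assms(2) by (simp add: dist_norm)
    finally show ?thesis by (simp add: algebra_simps)
  qed
  then show thesis
    using that[of "B + 1"] B(1) d(1) by (force simp: eventually_nhds_metric)
qed

section \<open>Steps defined implicitly cannot shrink the error superlinearly\<close>

text \<open>Here \<open>g\<close> and \<open>G\<close> are the gradients of \<open>l\<close> and \<open>R\<close>.\<close>

lemma not_superlinear_if_implicit_step: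
  fixes x :: "nat \<Rightarrow> real^'d" and G :: "real^'d \<Rightarrow> real^'d \<Rightarrow> real^'d"
  assumes S: "open S" "x0 \<in> S"
    and g: "(g has_derivative g') (at x0)" "g x0 = 0"
    and D: "\<And>z p. z \<in> S \<Longrightarrow> p \<in> S \<Longrightarrow> ((\<lambda>z. G z p) has_derivative (*v) (H z p)) (at z)"
    and cont: "isCont (\<lambda>(z, p). H z p) (x0, x0)"
    and rank: "rank (H x0 x0) = CARD('d)"
    and step: "\<And>t. g (x (Suc t)) = G (x t) (x t) - G (x (Suc t)) (x t)"
    and lim: "x \<longlonglongrightarrow> x0"
    and freq: "\<exists>\<^sub>F t in sequentially. x t \<noteq> x0"
  shows "\<not> converges_superlinearly x x0"
proof
  let ?A = "H x0 x0"
  assume sup: "converges_superlinearly x x0"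
  have "inj ((*v) ?A)"
    using rank by (simp add: full_rank_injective)
  then obtain c where c: "c > 0" "\<And>v. c * norm v \<le> norm (?A *v v)"
    using linear_inj_bounded_below_pos[OF matrix_vector_mul_linear] by blast
  \<comment> \<open>With tolerance \<open>c / 2\<close>, half of the lower bound \<open>c\<close>
    for \<open>?A\<close> survives the linearization error.\<close>
  obtain d where d: "d > 0"
    "\<And>z w p. z \<in> ball x0 d \<Longrightarrow> w \<in> ball x0 d \<Longrightarrow> p \<in> ball x0 d \<Longrightarrow>
       norm (G z p - G w p - ?A *v (z - w)) \<le> c / 2 * norm (z - w)"
    using parametric_linear_approximation[OF S S D cont, of "c / 2"] c(1) by auto
  obtain K where K: "K > 0" "\<forall>\<^sub>F z in nhds x0. norm (g z) \<le> K * norm (z - x0)"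
    using has_derivative_local_linear_bound[OF g] .
  \<comment> \<open>Chosen so that \<open>(K + c / 2) * r = c / 4\<close>, half the factor of the
    error in the final chain, which can then hold only for error zero.\<close>
  define r where "r = c / 2 / (2 * (K + c / 2))"
  have "r > 0" using c K by (simp add: r_def)
  have lim': "(\<lambda>t. x (Suc t)) \<longlonglongrightarrow> x0"
    using lim by (rule LIMSEQ_Suc)
  have "\<forall>\<^sub>F t in sequentially. norm (x (Suc t) - x0) \<le> r * norm (x t - x0)"
    using sup landau_o.smallD[OF _ \<open>r > 0\<close>] unfolding converges_superlinearly_def by fastforce
  moreover have "\<forall>\<^sub>F t in sequentially. x t \<in> ball x0 d"
    using lim d(1) by (simp add: tendsto_iff dist_commute)
  moreover have "\<forall>\<^sub>F t in sequentially. x (Suc t) \<in> ball x0 d"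
    using lim' d(1) by (simp add: tendsto_iff dist_commute)
  moreover have "\<forall>\<^sub>F t in sequentially. norm (g (x (Suc t))) \<le> K * norm (x (Suc t) - x0)"
    using K(2) lim' by (rule eventually_compose_filterlim)
  \<comment> \<open>The contradiction is indirect: the estimates force the sequence to reach its
    limit and stay there, which \<open>freq\<close> excludes.\<close>
  ultimately have "\<forall>\<^sub>F t in sequentially. x t = x0"
  proof eventually_elim
    case (elim t)
    let ?e = "norm (x t - x0)" and ?e' = "norm (x (Suc t) - x0)" and ?v = "x t - x (Suc t)"
    have "c * norm ?v \<le> norm (?A *v ?v)" by (rule c(2))
    also have "\<dots> \<le> norm (g (x (Suc t))) + norm (g (x (Suc t)) - ?A *v ?v)"
      using norm_triangle_ineq4[of "g (x (Suc t))" "g (x (Suc t)) - ?A *v ?v"] by simp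
    \<comment> \<open>By \<open>step\<close>, \<open>g (x (Suc t))\<close> is an increment of
      \<open>G\<close> in its first argument with parameter \<open>x t\<close>, so its distance from
      \<open>?A *v ?v\<close> is the linearization error.\<close>
    also have "\<dots> \<le> K * ?e' + c / 2 * norm ?v"
      using d(2)[OF elim(2,3,2)] elim(4) step[of t] by simp
    finally have "c / 2 * norm ?v \<le> K * ?e'" by simp
    moreover have "?e - ?e' \<le> norm ?v"
      using norm_triangle_ineq2[of "x t - x0" "x (Suc t) - x0"] by simp
    then have "c / 2 * (?e - ?e') \<le> c / 2 * norm ?v"
      using c(1) by (intro mult_left_mono) auto
    ultimately have "c / 2 * ?e \<le> (K + c / 2) * ?e'"
      by (simp add: algebra_simps)
    also have "\<dots> \<le> (K + c / 2) * (r * ?e)"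
      using elim(1) c K by (intro mult_left_mono) auto
    also have "\<dots> = (c / 2 * ?e) / 2"
    proof -
      have "K + c / 2 \<noteq> 0" using c(1) K(1) by simp
      then have "(K + c / 2) * r = c / 2 / 2" by (simp only: r_def) (simp add: field_simps)
      then show ?thesis by (metis mult.assoc mult.commute times_divide_eq_right)
    qed
    finally show "x t = x0"
      using c(1) by (simp add: mult_le_0_iff)
  qed
  with freq show False by (simp add: frequently_def)
qed

section \<open>Gibbs' inequality and the identity \<open>R = Q - l\<close>\<close>

text \<open>Concavity of the logarithm gives \<open>ln g - ln h \<le> (g - h) / h\<close> where
  \<open>h\<close> is positive; multiply by \<open>h\<close> and integrate.\<close>

lemma gibbs_inequality:
  assumes g: "integrable M g" "AE u in M. 0 \<le> g u"
    and h: "integrable M h" "AE u in M. 0 \<le> h u"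
    and mass: "(\<integral>u. g u \<partial>M) \<le> (\<integral>u. h u \<partial>M)"
    and gh: "real_log_expectation M g h" and hh: "real_log_expectation M h h"
  shows "(\<integral>u. ln (g u) * h u \<partial>M) \<le> (\<integral>u. ln (h u) * h u \<partial>M)"
proof -
  have int: "integrable M (\<lambda>u. ln (g u) * h u)" "integrable M (\<lambda>u. ln (h u) * h u)"
    and pos: "AE u in M. h u > 0 \<longrightarrow> g u > 0"
    using gh hh by (auto simp: real_log_expectation_def)
  have "AE u in M. ln (g u) * h u - ln (h u) * h u \<le> g u - h u"
    using g(2) h(2) pos
  proof eventually_elim
    case (elim u)
    show ?case
    proof (cases "h u > 0")
      case True
      then have "(ln (g u) - ln (h u)) * h u \<le> (g u - h u) / h u * h u"
        using elim ln_diff_le by (intro mult_right_mono) auto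
      also have "\<dots> = g u - h u" using True by simp
      finally show ?thesis by (simp add: algebra_simps)
    next
      case False
      \<comment> \<open>Here the factor \<open>h u\<close> kills both logarithmic terms, whatever
        the value of \<open>ln 0\<close>, and \<open>0 \<le> g u\<close> remains.\<close>
      then have "h u = 0" using elim by simp
      then show ?thesis using elim by simp
    qed
  qed
  then have "(\<integral>u. ln (g u) * h u - ln (h u) * h u \<partial>M) \<le> (\<integral>u. g u - h u \<partial>M)"
    using int g(1) h(1) by (intro integral_mono_AE) auto
  also have "\<dots> \<le> 0" using g(1) h(1) mass by simp
  finally show ?thesis using int by simp
qed

lemma integral_cond_density:
  assumes "0 < likelihood mu f y \<theta>"
  shows "(\<integral>u. cond_density mu f y \<theta> u \<partial>mu) = 1"
  using assms unfolding cond_density_def by (simp add: likelihood_def)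

text \<open>Where the conditional density at \<theta>' is positive, so is \<open>f\<close> at
  \<theta> almost everywhere, and the logarithm of the quotient splits. The constant
  \<open>loglik\<close> is then integrated against a density of mass 1.\<close>

lemma Rfun_eq_Qfun_minus_loglik:
  assumes L: "0 < likelihood mu f y \<theta>" "0 < likelihood mu f y \<theta>'"
    and nonneg: "\<And>u. 0 \<le> f y u \<theta>'" and int: "integrable mu (\<lambda>u. f y u \<theta>')"
    and E: "real_log_expectation mu (\<lambda>u. f y u \<theta>) (cond_density mu f y \<theta>')"
      "real_log_expectation mu (cond_density mu f y \<theta>) (cond_density mu f y \<theta>')"
  shows "Rfun mu f y \<theta> \<theta>' = Qfun mu f y \<theta> \<theta>' - loglik mu f y \<theta>"
proof -
  let ?h = "cond_density mu f y"
  have int_h: "integrable mu (?h \<theta>')"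
    unfolding cond_density_def using int by simp
  have pos: "AE u in mu. ?h \<theta>' u > 0 \<longrightarrow> f y u \<theta> > 0"
    and intQ: "integrable mu (\<lambda>u. ln (f y u \<theta>) * ?h \<theta>' u)"
    and intR: "integrable mu (\<lambda>u. ln (?h \<theta> u) * ?h \<theta>' u)"
    using E by (auto simp: real_log_expectation_def)
  have "AE u in mu. ln (?h \<theta> u) * ?h \<theta>' u
      = ln (f y u \<theta>) * ?h \<theta>' u - loglik mu f y \<theta> * ?h \<theta>' u"
    using pos
  proof eventually_elim
    case (elim u)
    have "0 \<le> ?h \<theta>' u" using nonneg L by (simp add: cond_density_def)
    show ?case
    proof (cases "?h \<theta>' u = 0")
      case False
      with \<open>0 \<le> ?h \<theta>' u\<close> elim have "f y u \<theta> > 0" by simp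
      then have "ln (?h \<theta> u) = ln (f y u \<theta>) - loglik mu f y \<theta>"
        using L by (simp add: cond_density_def loglik_def ln_div)
      then show ?thesis by (simp only: left_diff_distrib)
    qed simp
  qed
  then have "Rfun mu f y \<theta> \<theta>' = (\<integral>u. ln (f y u \<theta>) * ?h \<theta>' u - loglik mu f y \<theta> * ?h \<theta>' u \<partial>mu)"
    unfolding Rfun_def using intQ intR int_h
    by (intro integral_cong_AE) auto
  also have "\<dots> = Qfun mu f y \<theta> \<theta>' - loglik mu f y \<theta> * (\<integral>u. ?h \<theta>' u \<partial>mu)"
    unfolding Qfun_def using intQ int_h by simp
  finally show ?thesis by (simp add: integral_cond_density[OF L(2)])
qed

theorem theorem4:
  fixes P :: "real^'d \<Rightarrow> 'w measure"
    and Y :: "'w \<Rightarrow> real^'n" and U :: "'w \<Rightarrow> real^'q"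
    and lam :: "(real^'n) measure" and mu :: "(real^'q) measure"
    and f :: "real^'n \<Rightarrow> real^'q \<Rightarrow> real^'d \<Rightarrow> real"
    and \<Theta> :: "(real^'d) set" and y :: "real^'n"
    and \<theta> :: "nat \<Rightarrow> real^'d" and \<theta>star :: "real^'d"
  assumes "open \<Theta>"
    and "sets lam = sets borel" and "sets mu = sets borel"
    and "\<And>\<theta>. \<theta> \<in> \<Theta> \<Longrightarrow> prob_space (P \<theta>)"
    and "\<And>\<theta> y u. \<theta> \<in> \<Theta> \<Longrightarrow> 0 \<le> f y u \<theta>"
    and "\<And>\<theta>. \<theta> \<in> \<Theta> \<Longrightarrow>
           distributed (P \<theta>) (lam \<Otimes>\<^sub>M mu) (\<lambda>\<omega>. (Y \<omega>, U \<omega>)) (\<lambda>(y, u). ennreal (f y u \<theta>))"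
    and "\<And>\<theta>. \<theta> \<in> \<Theta> \<Longrightarrow> integrable mu (\<lambda>u. f y u \<theta>)"
    and "\<And>\<theta>. \<theta> \<in> \<Theta> \<Longrightarrow> 0 < likelihood mu f y \<theta>"
    and "\<And>\<theta> \<theta>'. \<theta> \<in> \<Theta> \<Longrightarrow> \<theta>' \<in> \<Theta> \<Longrightarrow>
           real_log_expectation mu (\<lambda>u. f y u \<theta>) (cond_density mu f y \<theta>')"
    and "\<And>\<theta> \<theta>'. \<theta> \<in> \<Theta> \<Longrightarrow> \<theta>' \<in> \<Theta> \<Longrightarrow>
           real_log_expectation mu (cond_density mu f y \<theta>) (cond_density mu f y \<theta>')"
    and "em_sequence \<Theta> (Qfun mu f y) \<theta>"
    and "\<theta>star \<in> \<Theta>" and "\<theta> \<longlonglongrightarrow> \<theta>star"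
    and "\<exists>\<^sub>F t in sequentially. \<theta> t \<noteq> \<theta>star"
    and "gradient (loglik mu f y) \<theta>star = 0"
    and "C2_on \<Theta> (loglik mu f y)"
    and "\<And>\<theta>'. \<theta>' \<in> \<Theta> \<Longrightarrow> C2_on \<Theta> (\<lambda>\<theta>. Qfun mu f y \<theta> \<theta>')"
    and "\<And>\<theta>'. \<theta>' \<in> \<Theta> \<Longrightarrow> C2_on \<Theta> (\<lambda>\<theta>. Rfun mu f y \<theta> \<theta>')"
    and "isCont (\<lambda>(\<theta>, \<theta>'). hessian (\<lambda>\<theta>. Rfun mu f y \<theta> \<theta>') \<theta>) (\<theta>star, \<theta>star)"
    and "rank (hessian (loglik mu f y) \<theta>star) = CARD('d)"
    and "rank (hessian (\<lambda>\<theta>. Qfun mu f y \<theta> \<theta>star) \<theta>star) = CARD('d)"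
    and "rank (hessian (\<lambda>\<theta>. Rfun mu f y \<theta> \<theta>star) \<theta>star) = CARD('d)"
  shows "\<not> converges_superlinearly \<theta> \<theta>star"
proof -
  note op = assms(1) and f_nonneg = assms(5) and int = assms(7) and L = assms(8)
    and EQ = assms(9) and ER = assms(10) and em = assms(11) and star = assms(12)
    and C2l = assms(16) and C2Q = assms(17) and C2R = assms(18)
  let ?h = "cond_density mu f y"
  have inTheta: "\<theta> t \<in> \<Theta>" for t
    using em by (simp add: em_sequence_def)
  have R_eq: "Rfun mu f y a b = Qfun mu f y a b - loglik mu f y a" if "a \<in> \<Theta>" "b \<in> \<Theta>" for a b
    using that by (intro Rfun_eq_Qfun_minus_loglik L f_nonneg int EQ ER)
  have R_max: "Rfun mu f y a b \<le> Rfun mu f y b b" if "a \<in> \<Theta>" "b \<in> \<Theta>" for a b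
    unfolding Rfun_def
  proof (rule gibbs_inequality)
    show "integrable mu (?h a)" "integrable mu (?h b)"
      unfolding cond_density_def using int that by auto
    show "AE u in mu. 0 \<le> ?h a u" "AE u in mu. 0 \<le> ?h b u"
      unfolding cond_density_def using f_nonneg L that by (auto simp: less_imp_le)
    show "integral\<^sup>L mu (?h a) \<le> integral\<^sup>L mu (?h b)"
      using integral_cond_density[OF L] that by simp
  qed (use ER that in auto)
  have grad_R: "gradient (\<lambda>a. Rfun mu f y a b) b = 0" if "b \<in> \<Theta>" for b
    using C2R[OF that] that R_max by (intro gradient_zero_at_max[OF op]) (auto simp: C2_on_def)
  have grad_Q: "gradient (\<lambda>a. Qfun mu f y a (\<theta> t)) (\<theta> (Suc t)) = 0" for t
    using C2Q[OF inTheta[of t]] inTheta em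
    by (intro gradient_zero_at_max[OF op]) (auto simp: C2_on_def em_sequence_def)
  \<comment> \<open>The left side does not involve \<open>b\<close>, so \<open>b\<close> may be
    taken as the previous iterate when \<open>a\<close> is the current one.\<close>
  have grad_l: "gradient (loglik mu f y) a =
      gradient (\<lambda>a. Qfun mu f y a b) a - gradient (\<lambda>a. Rfun mu f y a b) a"
    if "a \<in> \<Theta>" "b \<in> \<Theta>" for a b
    using C2Q[OF that(2)] C2R[OF that(2)] that R_eq
    by (intro gradient_diff[OF op]) (auto simp: C2_on_def)
  show ?thesis
  proof (rule not_superlinear_if_implicit_step[
      where g = "gradient (loglik mu f y)" and x = \<theta> and ?x0.0 = \<theta>star
        and G = "\<lambda>a b. gradient (\<lambda>a. Rfun mu f y a b) a"
        and H = "\<lambda>a b. hessian (\<lambda>a. Rfun mu f y a b) a",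
      OF op star _ assms(15) _ assms(19,22) _ assms(13,14)])
    show "(gradient (loglik mu f y) has_derivative (*v) (hessian (loglik mu f y) \<theta>star)) (at \<theta>star)"
      using C2l star by (intro gradient_has_derivative_hessian) (simp add: C2_on_def)
    show "((\<lambda>a. gradient (\<lambda>a. Rfun mu f y a b) a) has_derivative
        (*v) (hessian (\<lambda>a. Rfun mu f y a b) a)) (at a)" if "a \<in> \<Theta>" "b \<in> \<Theta>" for a b
      using C2R[OF that(2)] that(1)
      by (intro gradient_has_derivative_hessian) (simp add: C2_on_def)
    \<comment> \<open>The \<open>Q\<close> term vanishes by the M-step. The first \<open>R\<close>
      term is zero by \<open>grad_R\<close>; it is written out to exhibit an increment of the
      gradient of \<open>R\<close> with the second argument fixed.\<close>
    show "gradient (loglik mu f y) (\<theta> (Suc t)) =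
        gradient (\<lambda>a. Rfun mu f y a (\<theta> t)) (\<theta> t)
        - gradient (\<lambda>a. Rfun mu f y a (\<theta> t)) (\<theta> (Suc t))" for t
      using grad_l[OF inTheta inTheta, of "Suc t" t] grad_Q grad_R[OF inTheta] by simp
  qed
qed

end
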